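(* Let $m,n\ge 1$, let $\omega\in(0,1]$, let $A\in\mathbb{R}^{m\times n}$ be any matrix, and let $\bar A$ be its principal order matrix. If $(i_1,\ldots,i_n)\in\mathcal{I}(\bar A,\omega)$, then the following conditions hold: (i) $\mathrm{idx}_1(\bar A,\bar A(i_1,1))\cup\cdots\cup\mathrm{idx}_n(\bar A,\bar A(i_n,n))=M$; (ii) $mp+n-f\le \bar A(i_1,1)+\cdots+\bar A(i_n,n)\le mp+n-m$, where $p=\lceil\omega n\rceil$ and $f=f_1+\cdots+f_n$.
   Context: Let $M=\{1,\ldots,m\}$, $N=\{1,\ldots,n\}$. For $\omega\in(0,1]$, $A\in\mathbb{R}^{m\times n}$ and $x\in\mathbb{R}^n$, $A\otimes_\omega x\in\mathbb{R}^m$ is the vector whose $i$-th entry is the $\lceil\omega n\rceil$-th smallest element (counted with multiplicity) of the multiset $\{A(i,j)+x_j : j\in N\}$. The normalized equation is $A\otimes_\omega x=\mathbf{0}$, with solution set $\mathcal{S}(A,\omega)=\{x\in\mathbb{R}^n : A\otimes_\omega x=\mathbf{0}\}$. For $x\in\mathcal{S}(A,\omega)$ put $\mathcal{I}(A,\omega,x)=\{(i_1,\ldots,i_n)\in M^n : A(i_k,k)+x_k=0\text{ for all }k\in N\}$, and define the set of solution indices $\mathcal{I}(A,\omega)=\bigcup_{x\in\mathcal{S}(A,\omega)}\mathcal{I}(A,\omega,x)$ (and likewise with $\bar A$ in place of $A$). For a matrix $A$ and $r\in\mathbb{R}$, $\mathrm{idx}_j(A,r)=\{i\in M : A(i,j)=r\}$.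 The principal order matrix $\bar A$ of a general matrix $A\in\mathbb{R}^{m\times n}$ (columns may have repeated entries) is defined by $\bar A(i,j)=1+|\{i'\in M : A(i',j)<A(i,j)\}|$ for $i\in M$, $j\in N$. For $j\in N$, $f_j=\max\{|\mathrm{idx}_j(\bar A,1)|,|\mathrm{idx}_j(\bar A,2)|,\ldots,|\mathrm{idx}_j(\bar A,m)|\}$ is the largest number of appearances of a single value in the $j$-th column of $\bar A$. *)

theory Defs
  imports "HOL-Analysis.Analysis" "HOL-Library.Multiset"
begin

text \<open>
  The index sets \<open>M\<close> and \<open>N\<close> are the finite index types \<open>'m\<close> and \<open>'n\<close>, so
  \<open>m = CARD('m) \<ge> 1\<close> and \<open>n = CARD('n) \<ge> 1\<close>. Row \<open>i\<close>, column \<open>j\<close> of \<open>A\<close> is \<open>A $ i $ j\<close>,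
  and a tuple \<open>(i\<^sub>1, \<dots>, i\<^sub>n) \<in> M\<^sup>n\<close> is a function \<open>'n \<Rightarrow> 'm\<close>.
\<close>

text \<open>
  Lists are indexed from \<open>0\<close>, so the \<open>p\<close>-th smallest element is at position \<open>p - 1\<close>.
  For \<open>0 < \<omega> \<le> 1\<close> one has \<open>1 \<le> \<lceil>\<omega> n\<rceil> \<le> n\<close>, so the position is valid; for other \<open>\<omega>\<close> the
  value has no meaning.
\<close>

definition omega_prod :: "real \<Rightarrow> real^'n^'m \<Rightarrow> real^'n \<Rightarrow> real^'m" where
  "omega_prod \<omega> A x =
     (\<chi> i. sorted_list_of_multiset {# A $ i $ j + x $ j. j \<in># mset_set UNIV #}
            ! (nat \<lceil>\<omega> * real CARD('n)\<rceil> - 1))"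

definition solution_set :: "real^'n^'m \<Rightarrow> real \<Rightarrow> (real^'n) set" where
  "solution_set A \<omega> = {x. omega_prod \<omega> A x = 0}"

definition solution_indices_at :: "real^'n^'m \<Rightarrow> real^'n \<Rightarrow> ('n \<Rightarrow> 'm) set" where
  "solution_indices_at A x = {\<iota>. \<forall>k. A $ \<iota> k $ k + x $ k = 0}"

definition solution_indices :: "real^'n^'m \<Rightarrow> real \<Rightarrow> ('n \<Rightarrow> 'm) set" where
  "solution_indices A \<omega> = (\<Union>x\<in>solution_set A \<omega>. solution_indices_at A x)"

definition idx :: "'n \<Rightarrow> real^'n^'m \<Rightarrow> real \<Rightarrow> 'm set" where
  "idx j A r = {i. A $ i $ j = r}"

definition principal_order :: "real^'n^'m \<Rightarrow> real^'n^'m" where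
  "principal_order A = (\<chi> i j. 1 + real (card {i'. A $ i' $ j < A $ i $ j}))"

definition max_appearances :: "real^'n^'m \<Rightarrow> 'n \<Rightarrow> nat" where
  "max_appearances A j =
     Max ((\<lambda>r. card (idx j (principal_order A) (real r))) ` {1..CARD('m)})"

end

theory Submission
  imports Defs
begin

text \<open>
  Write \<open>B\<close> for the principal order matrix, \<open>p = \<lceil>\<omega> n\<rceil>\<close>, and let \<open>x\<close> be a solution realising
  the index tuple \<open>\<iota>\<close>. Then \<open>x\<^sub>j = - B(\<iota>\<^sub>j, j)\<close>, so the equation for row \<open>i\<close> says that the
  \<open>p\<close>-th smallest of the differences \<open>B(i, j) - B(\<iota>\<^sub>j, j)\<close> is \<open>0\<close>. Being the \<open>p\<close>-th smallest means
  three things: some difference vanishes, fewer than \<open>p\<close> of them are negative, and at least \<open>p\<close>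
  are nonpositive (\<open>kth_smallest_of_family\<close>). The first gives the covering condition (i).

  The other two are summed over all rows and the pairs \<open>(i, j)\<close> are counted column by column.
  In a column, the entries of \<open>B\<close> are competition ranks, so exactly \<open>B(\<iota>\<^sub>j, j) - 1\<close> rows lie
  strictly below \<open>B(\<iota>\<^sub>j, j)\<close> (\<open>card_below_principal_order\<close>), and at most \<open>f\<^sub>j\<close> rows tie with it
  (\<open>card_tie_le_max_appearances\<close>). Hence the sum of \<open>B(\<iota>\<^sub>j, j) - 1\<close> is at most \<open>m (p - 1)\<close>, while
  the sum of \<open>B(\<iota>\<^sub>j, j) - 1 + f\<^sub>j\<close> is at least \<open>m p\<close>; these are the two bounds in (ii).
\<close>

lemma sorted_nth_card_below:
  assumes "sorted xs" "k < length xs"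
  shows "length (filter (\<lambda>y. y < xs ! k) xs) \<le> k"
    and "Suc k \<le> length (filter (\<lambda>y. y \<le> xs ! k) xs)"
proof -
  have "{i. i < length xs \<and> xs ! i < xs ! k} \<subseteq> {..<k}"
    using assms by (auto simp: not_le[symmetric] dest: sorted_nth_mono)
  then show "length (filter (\<lambda>y. y < xs ! k) xs) \<le> k"
    using card_mono[of "{..<k}"] by (fastforce simp: length_filter_conv_card)
  have "{..k} \<subseteq> {i. i < length xs \<and> xs ! i \<le> xs ! k}"
    using assms by (auto intro: sorted_nth_mono)
  then show "Suc k \<le> length (filter (\<lambda>y. y \<le> xs ! k) xs)"
    using card_mono[of "{i. i < length xs \<and> xs ! i \<le> xs ! k}" "{..k}"]
    by (simp add: length_filter_conv_card)
qed

lemma length_filter_sorted_family: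
  fixes f :: "'n::finite \<Rightarrow> 'a::linorder"
  shows "length (filter P (sorted_list_of_multiset {# f j. j \<in># mset_set UNIV #}))
    = card {j. P (f j)}"
proof -
  have "length (filter P (sorted_list_of_multiset {# f j. j \<in># mset_set UNIV #}))
      = size (filter_mset P {# f j. j \<in># mset_set UNIV #})"
    by (metis mset_filter mset_sorted_list_of_multiset size_mset)
  also have "\<dots> = card {j. P (f j)}"
    by (simp add: filter_mset_image_mset)
  finally show ?thesis .
qed

text \<open>
  Order statistics expressed by counting: this replaces the sorted list by statements about
  cardinalities of index sets, which can then be summed.
\<close>
lemma kth_smallest_of_family:
  fixes f :: "'n::finite \<Rightarrow> 'a::linorder"
  assumes k: "k < CARD('n)"
    and v: "sorted_list_of_multiset {# f j. j \<in># mset_set UNIV #} ! k = v"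
  shows "\<exists>j. f j = v" and "card {j. f j < v} \<le> k" and "Suc k \<le> card {j. f j \<le> v}"
proof -
  let ?xs = "sorted_list_of_multiset {# f j. j \<in># mset_set UNIV #}"
  have len: "k < length ?xs"
    using k length_filter_sorted_family[of "\<lambda>_. True" f] by simp
  have "v \<in> set ?xs" using nth_mem[OF len] v by simp
  then show "\<exists>j. f j = v" by auto
  have s: "sorted ?xs" by simp
  show "card {j. f j < v} \<le> k"
    using sorted_nth_card_below(1)[OF s len] unfolding v length_filter_sorted_family .
  show "Suc k \<le> card {j. f j \<le> v}"
    using sorted_nth_card_below(2)[OF s len] unfolding v length_filter_sorted_family .
qed

lemma principal_order_less_iff:
  "principal_order A $ i $ j < principal_order A $ i' $ j \<longleftrightarrow> A $ i $ j < A $ i' $ j"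
proof
  assume "A $ i $ j < A $ i' $ j"
  then have "{k. A $ k $ j < A $ i $ j} \<subset> {k. A $ k $ j < A $ i' $ j}" by force
  then show "principal_order A $ i $ j < principal_order A $ i' $ j"
    by (simp add: principal_order_def psubset_card_mono)
next
  assume less: "principal_order A $ i $ j < principal_order A $ i' $ j"
  show "A $ i $ j < A $ i' $ j"
  proof (rule ccontr)
    assume "\<not> A $ i $ j < A $ i' $ j"
    then have "card {k. A $ k $ j < A $ i' $ j} \<le> card {k. A $ k $ j < A $ i $ j}"
      by (intro card_mono) auto
    with less show False by (simp add: principal_order_def)
  qed
qed

text \<open>
  Passing to the principal order matrix preserves the order inside each column, so ranking the
  ranks changes nothing.
\<close>
lemma card_below_principal_order:
  "real (card {i'. principal_order A $ i' $ j < principal_order A $ i $ j})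
    = principal_order A $ i $ j - 1"
  by (simp only: principal_order_less_iff) (simp add: principal_order_def)

text \<open>
  The rank of an entry is an integer between \<open>1\<close> and \<open>m\<close>: the entry is not below itself. Hence
  its tie class is among those over which the maximum is taken.
\<close>
lemma card_tie_le_max_appearances:
  fixes A :: "real^'n^'m"
  shows "card {i'. principal_order A $ i' $ j = principal_order A $ i $ j} \<le> max_appearances A j"
proof -
  define r where "r = Suc (card {i'. A $ i' $ j < A $ i $ j})"
  have "{i'. A $ i' $ j < A $ i $ j} \<subset> UNIV" by blast
  then have "r \<in> {1..CARD('m)}"
    using psubset_card_mono[of "UNIV :: 'm set"] by (auto simp: r_def Suc_le_eq)
  moreover have "principal_order A $ i $ j = real r"
    by (simp add: principal_order_def r_def)
  ultimately show ?thesis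
    unfolding max_appearances_def by (intro Max_ge) (auto simp: idx_def)
qed

lemma card_le_split:
  fixes g :: "'a::finite \<Rightarrow> 'b::linorder"
  shows "card {i. g i \<le> c} = card {i. g i < c} + card {i. g i = c}"
proof -
  have "{i. g i \<le> c} = {i. g i < c} \<union> {i. g i = c}" by auto
  moreover have "{i. g i < c} \<inter> {i. g i = c} = {}" by auto
  ultimately show ?thesis by (simp add: card_Un_disjoint)
qed

lemma sum_card_rows_eq_sum_card_columns:
  fixes P :: "'m::finite \<Rightarrow> 'n::finite \<Rightarrow> bool"
  shows "(\<Sum>i\<in>UNIV. card {j. P i j}) = (\<Sum>j\<in>UNIV. card {i. P i j})"
  using sum.swap_restrict[of UNIV UNIV "\<lambda>_ _. 1::nat" P] by simp

theorem proposition4p1: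
  fixes A :: "real^'n^'m" and \<omega> :: real and \<iota> :: "'n \<Rightarrow> 'm"
  assumes "0 < \<omega>" and "\<omega> \<le> 1"
    and "\<iota> \<in> solution_indices (principal_order A) \<omega>"
  shows "(\<Union>j. idx j (principal_order A) (principal_order A $ \<iota> j $ j)) = UNIV
    \<and> real CARD('m) * real_of_int \<lceil>\<omega> * real CARD('n)\<rceil> + real CARD('n)
          - real (\<Sum>j\<in>UNIV. max_appearances A j)
        \<le> (\<Sum>j\<in>UNIV. principal_order A $ \<iota> j $ j)
    \<and> (\<Sum>j\<in>UNIV. principal_order A $ \<iota> j $ j)
        \<le> real CARD('m) * real_of_int \<lceil>\<omega> * real CARD('n)\<rceil> + real CARD('n) - real CARD('m)"
proof -
  define B where "B = principal_order A"
  define c where "c j = B $ \<iota> j $ j" for j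
  define p where "p = \<lceil>\<omega> * real CARD('n)\<rceil>"
  \<comment> \<open>\<open>k\<close> is the list position \<open>p - 1\<close>; truncated subtraction is harmless because \<open>p \<ge> 1\<close>.\<close>
  define k where "k = nat p - 1"
  have "0 < \<omega> * real CARD('n)" using assms(1) by simp
  moreover have "\<omega> * real CARD('n) \<le> real CARD('n)"
    using assms(1,2) by (simp add: mult_left_le_one_le)
  ultimately have "1 \<le> p" "p \<le> int CARD('n)"
    by (simp_all add: p_def ceiling_le_iff)
  then have p: "p = int k + 1" and "int k < int CARD('n)"
    by (simp_all add: k_def of_nat_diff Suc_le_eq)
  then have k: "k < CARD('n)" by (simp only: of_nat_less_iff)
  obtain x where x: "omega_prod \<omega> B x = 0" and "\<And>j. B $ \<iota> j $ j + x $ j = 0"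
    using assms(3) by (auto simp: solution_indices_def solution_set_def solution_indices_at_def B_def)
  then have xc: "x $ j = - c j" for j by (simp add: c_def add_eq_0_iff)
  have row: "sorted_list_of_multiset {# B $ i $ j + x $ j. j \<in># mset_set UNIV #} ! k = 0" for i
    using arg_cong[OF x, of "\<lambda>y. y $ i"] by (simp add: omega_prod_def k_def p_def)
  have hit: "\<exists>j. B $ i $ j = c j"
    and few: "card {j. B $ i $ j < c j} \<le> k"
    and many: "Suc k \<le> card {j. B $ i $ j \<le> c j}" for i
    using kth_smallest_of_family[OF k row[of i]] by (simp_all add: xc)

  have cover: "(\<Union>j. idx j B (c j)) = UNIV"
    using hit by (auto simp: idx_def)

  have below: "real (card {i. B $ i $ j < c j}) = c j - 1" for j
    unfolding B_def c_def by (rule card_below_principal_order)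
  have tie: "card {i. B $ i $ j = c j} \<le> max_appearances A j" for j
    unfolding B_def c_def by (rule card_tie_le_max_appearances)

  have "(\<Sum>j\<in>UNIV. c j - 1) = real (\<Sum>j\<in>UNIV. card {i. B $ i $ j < c j})"
    by (simp add: below)
  also have "\<dots> = real (\<Sum>i\<in>UNIV. card {j. B $ i $ j < c j})"
    by (rule arg_cong[OF sum_card_rows_eq_sum_card_columns[symmetric]])
  also have "\<dots> \<le> real (\<Sum>i\<in>(UNIV::'m set). k)"
    by (intro of_nat_mono sum_mono few)
  finally have upper: "(\<Sum>j\<in>UNIV. c j) - real CARD('n) \<le> real CARD('m) * real k"
    by (simp add: sum_subtractf)

  have "real (\<Sum>i\<in>(UNIV::'m set). Suc k) \<le> real (\<Sum>i\<in>UNIV. card {j. B $ i $ j \<le> c j})"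
    by (intro of_nat_mono sum_mono many)
  also have "\<dots> = real (\<Sum>j\<in>UNIV. card {i. B $ i $ j \<le> c j})"
    by (rule arg_cong[OF sum_card_rows_eq_sum_card_columns])
  also have "\<dots> = (\<Sum>j\<in>UNIV. c j - 1 + real (card {i. B $ i $ j = c j}))"
    by (simp add: card_le_split below)
  also have "\<dots> \<le> (\<Sum>j\<in>UNIV. c j - 1 + real (max_appearances A j))"
    by (intro sum_mono add_left_mono of_nat_mono tie)
  finally have lower: "real CARD('m) * (real k + 1)
      \<le> (\<Sum>j\<in>UNIV. c j) - real CARD('n) + real (\<Sum>j\<in>UNIV. max_appearances A j)"
    by (simp add: sum_subtractf sum.distrib algebra_simps)

  show ?thesis
    using cover upper lower unfolding p_def[symmetric] p c_def B_def
    by (simp add: algebra_simps)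
qed

end
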